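(* Let $(V,\Diamond)$ be a $K4$ modal algebra. If $(V,\Diamond)$ does not contain an infinite descending $\Diamond$-tower, then $(V,\Diamond)$ is locally finite.
   Context: A modal algebra $(V,\Diamond)$ is a Boolean algebra $V$ with a normal modal operator $\Diamond$, i.e. $\Diamond 0=0$ and $\Diamond(a\vee b)=\Diamond a\vee\Diamond b$. It is a $K4$ modal algebra if it validates $\Diamond\Diamond p\to\Diamond p$, i.e. $\Diamond\Diamond a\le\Diamond a$ for all $a\in V$. An algebra is locally finite if each of its finitely generated subalgebras is finite (subalgebras here are closed under the Boolean operations and $\Diamond$). A modal algebra $(V,\Diamond)$ contains an infinite descending $\Diamond$-tower if there are nonzero, pairwise disjoint elements $T_1,T_2,T_3,\dots\in V$ (indexed by the positive integers; disjoint means $T_i\wedge T_j=0$ for $i\ne j$) such that for all $i\geq 1$: (i) $T_{i+1}\le\Diamond T_i$; (ii) $T_i\wedge\Diamond T_{i+1}=0$. *)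

theory Defs
  imports Main "HOL.Hull"
begin

unbundle lattice_syntax

locale modal_algebra =
  fixes dia :: "'a::boolean_algebra \<Rightarrow> 'a"
  assumes dia_bot: "dia \<bottom> = \<bottom>"
    and dia_sup: "dia (a \<squnion> b) = dia a \<squnion> dia b"

locale K4_modal_algebra = modal_algebra dia
  for dia :: "'a::boolean_algebra \<Rightarrow> 'a" +
  assumes dia_dia_le: "dia (dia a) \<le> dia a"

definition subalgebra :: "('a::boolean_algebra \<Rightarrow> 'a) \<Rightarrow> 'a set \<Rightarrow> bool" where
  "subalgebra dia B \<longleftrightarrow>
     \<bottom> \<in> B \<and> \<top> \<in> B \<and>
     (\<forall>a\<in>B. \<forall>b\<in>B. a \<squnion> b \<in> B \<and> a \<sqinter> b \<in> B) \<and>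
     (\<forall>a\<in>B. - a \<in> B \<and> dia a \<in> B)"

definition finitely_generated :: "('a::boolean_algebra \<Rightarrow> 'a) \<Rightarrow> 'a set \<Rightarrow> bool" where
  "finitely_generated dia B \<longleftrightarrow> (\<exists>G. finite G \<and> B = subalgebra dia hull G)"

definition locally_finite :: "('a::boolean_algebra \<Rightarrow> 'a) \<Rightarrow> bool" where
  "locally_finite dia \<longleftrightarrow>
     (\<forall>B. subalgebra dia B \<and> finitely_generated dia B \<longrightarrow> finite B)"

text \<open>Towers are indexed by the positive integers; the value \<open>T 0\<close> plays no role.\<close>

definition descending_tower :: "('a::boolean_algebra \<Rightarrow> 'a) \<Rightarrow> (nat \<Rightarrow> 'a) \<Rightarrow> bool" where
  "descending_tower dia T \<longleftrightarrow>
     (\<forall>i\<ge>1. T i \<noteq> \<bottom>) \<and>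
     (\<forall>i\<ge>1. \<forall>j\<ge>1. i \<noteq> j \<longrightarrow> T i \<sqinter> T j = \<bottom>) \<and>
     (\<forall>i\<ge>1. T (i + 1) \<le> dia (T i)) \<and>
     (\<forall>i\<ge>1. T i \<sqinter> dia (T (i + 1)) = \<bottom>)"

end

theory Submission
  imports Defs
begin

text \<open>
  Think of the algebra as a transitive frame, with \<open>dia a\<close> the set of points that see \<open>a\<close>, and
  let \<open>B\<close> be an infinite subalgebra generated by a finite set \<open>G\<close>. The tower is the sequence of
  layers of points of depth 1, 2, 3, \<dots>. Suppose the union \<open>D\<close> of the layers found so far
  is closed under successors and is a finite union of cells, each of which lies inside or outside
  every member of \<open>B\<close>. Colour points by the generators they belong to and by the cells of \<open>D\<close>
  they see. As there are finitely many colours, ``maximal outside \<open>D\<close>'' can be replaced by a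
  condition on colours, expressed by an element of the algebra: all successors outside \<open>D\<close> of the
  point see, outside \<open>D\<close>, every colour that the point has or sees there. On this new layer, membership in
  members of \<open>B\<close> depends only on the colour of a point and on the colours it sees, so the layer
  again splits into finitely many cells. If some layer were empty, then \<open>D\<close> would be everything
  and \<open>B\<close> would be finite.
\<close>

section \<open>Finite joins and cells that decide elements\<close>

definition fjoin :: "'a::boolean_algebra set \<Rightarrow> 'a" where
  "fjoin A = Finite_Set.fold sup \<bottom> A"

lemma fjoin_empty [simp]: "fjoin {} = \<bottom>"
  by (simp add: fjoin_def)

lemma fjoin_insert [simp]: "finite A \<Longrightarrow> fjoin (insert a A) = a \<squnion> fjoin A"
  unfolding fjoin_def by (metis comp_fun_idem_on.fold_insert_idem comp_fun_idem_sup comp_fun_idem_def' subset_UNIV)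

lemma fjoin_le_iff: "finite A \<Longrightarrow> fjoin A \<le> x \<longleftrightarrow> (\<forall>a\<in>A. a \<le> x)"
  by (induction A rule: finite_induct) auto

lemma fjoin_upper: "finite A \<Longrightarrow> a \<in> A \<Longrightarrow> a \<le> fjoin A"
  using fjoin_le_iff by blast

lemma fjoin_Un: "finite A \<Longrightarrow> finite A' \<Longrightarrow> fjoin (A \<union> A') = fjoin A \<squnion> fjoin A'"
  by (induction A rule: finite_induct) (auto simp: sup_assoc)

lemma inf_fjoin: "finite A \<Longrightarrow> x \<sqinter> fjoin A = fjoin ((\<lambda>a. x \<sqinter> a) ` A)"
  by (induction A rule: finite_induct) (auto simp: inf_sup_distrib1)

text \<open>The zero element decides everything, so cells obtained as meets need not be checked for
  being nonzero.\<close>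

definition decides :: "'a::boolean_algebra \<Rightarrow> 'a \<Rightarrow> bool" where
  "decides c b \<longleftrightarrow> c \<le> b \<or> c \<le> - b"

lemma decides_mono: "decides c b \<Longrightarrow> c' \<le> c \<Longrightarrow> decides c' b"
  unfolding decides_def by (meson order_trans)

lemma decides_uminus: "decides c b \<Longrightarrow> decides c (- b)"
  unfolding decides_def by auto

lemma decides_sup: "decides c a \<Longrightarrow> decides c b \<Longrightarrow> decides c (a \<squnion> b)"
  unfolding decides_def by (auto intro: le_supI1 le_supI2)

lemma decides_inf: "decides c a \<Longrightarrow> decides c b \<Longrightarrow> decides c (a \<sqinter> b)"
  unfolding decides_def by (auto intro: le_supI1 le_supI2)

lemma decides_fjoin: "finite A \<Longrightarrow> \<forall>a\<in>A. decides c a \<Longrightarrow> decides c (fjoin A)"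
  by (induction A rule: finite_induct) (auto intro: decides_sup simp: decides_def[of c \<bottom>])

text \<open>Each new \<open>e\<close> splits every cell into its parts inside and outside
  \<open>e\<close>. The set \<open>P\<close> lets the cells keep a property that is stable under
  complement and meet.\<close>

lemma finite_cover_deciding:
  fixes E :: "'a::boolean_algebra set"
  assumes "finite E" "E \<subseteq> P" "\<top> \<in> P"
    and "\<And>a. a \<in> P \<Longrightarrow> - a \<in> P" "\<And>a b. a \<in> P \<Longrightarrow> b \<in> P \<Longrightarrow> a \<sqinter> b \<in> P"
  shows "\<exists>K. finite K \<and> K \<subseteq> P \<and> fjoin K = \<top> \<and> (\<forall>k\<in>K. \<forall>e\<in>E. decides k e)"
  using assms(1,2)
proof (induction E rule: finite_induct)
  case empty
  have "fjoin {\<top>::'a} = \<top>" by simp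
  then show ?case using assms(3) by blast
next
  case (insert e E)
  then obtain K where K: "finite K" "K \<subseteq> P" "fjoin K = \<top>" "\<forall>k\<in>K. \<forall>e\<in>E. decides k e"
    by auto
  let ?K = "(\<lambda>k. e \<sqinter> k) ` K \<union> (\<lambda>k. - e \<sqinter> k) ` K"
  have "fjoin ?K = \<top>"
    using K(1,3) by (simp add: fjoin_Un inf_fjoin[symmetric])
  moreover have "?K \<subseteq> P"
    using insert.prems K(2) assms(4,5) by auto
  moreover have "\<forall>k\<in>?K. \<forall>a\<in>insert e E. decides k a"
    using K(4) by (auto simp: decides_def intro: le_infI1 le_infI2)
  moreover have "finite ?K" using K(1) by simp
  ultimately show ?case by (intro exI[of _ ?K] conjI)
qed

lemma fjoin_decided_eq:
  assumes "finite A" "\<forall>c\<in>A. decides c b"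
  shows "b \<sqinter> fjoin A = fjoin {c \<in> A. c \<le> b}"
proof (rule antisym)
  have "b \<sqinter> c \<le> fjoin {c \<in> A. c \<le> b}" if "c \<in> A" for c
  proof (cases "c \<le> b")
    case True
    then show ?thesis
      using that assms(1) by (intro le_infI2 fjoin_upper) auto
  next
    case False
    then have "c \<le> - b" using that assms(2) by (auto simp: decides_def)
    then have "b \<sqinter> c = \<bottom>" by (metis inf.commute inf_shunt)
    then show ?thesis by simp
  qed
  then show "b \<sqinter> fjoin A \<le> fjoin {c \<in> A. c \<le> b}"
    using assms(1) by (simp add: inf_fjoin fjoin_le_iff)
  show "fjoin {c \<in> A. c \<le> b} \<le> b \<sqinter> fjoin A"
    using assms(1) by (auto simp: fjoin_le_iff intro: fjoin_upper)
qed

text \<open>A member of \<open>B\<close> is the join of the cells below it, so it is determined by a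
  subset of \<open>A\<close>.\<close>

lemma finite_if_decided_by_cover:
  assumes "finite A" "fjoin A = \<top>" "\<forall>c\<in>A. \<forall>b\<in>B. decides c b"
  shows "finite B"
proof (rule finite_subset)
  show "B \<subseteq> fjoin ` Pow A"
  proof
    fix b assume "b \<in> B"
    then have "b = fjoin {c \<in> A. c \<le> b}"
      using fjoin_decided_eq[of A b] assms by simp
    then show "b \<in> fjoin ` Pow A" by blast
  qed
  show "finite (fjoin ` Pow A)" using assms(1) by simp
qed

section \<open>The modal operator and settled points\<close>

context modal_algebra
begin

lemma dia_mono: "a \<le> b \<Longrightarrow> dia a \<le> dia b"
  by (metis dia_sup le_iff_sup)

lemma dia_fjoin: "finite A \<Longrightarrow> dia (fjoin A) = fjoin (dia ` A)"
  by (induction A rule: finite_induct) (simp_all add: dia_bot dia_sup)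

lemma dia_le_dia_inf_sup: "dia a \<le> dia (a \<sqinter> b) \<squnion> dia (- b)"
  by (metis dia_sup dia_mono sup_neg_inf inf.idem inf_le2 le_inf_iff le_supI1 sup.commute
      order_refl double_compl)

end

text \<open>An irreflexive point without successors satisfies this condition vacuously.\<close>

definition settled :: "('a::boolean_algebra \<Rightarrow> 'a) \<Rightarrow> 'a set \<Rightarrow> 'a" where
  "settled dia K = - fjoin ((\<lambda>e. (e \<squnion> dia e) \<sqinter> dia (- dia e)) ` K)"

context K4_modal_algebra
begin

text \<open>Counting only successors in \<open>U\<close> keeps the relation transitive. With
  \<open>U\<close> the complement of the layers found so far, all facts on settled points apply to
  what remains.\<close>

lemma K4_relativize: "K4_modal_algebra (\<lambda>a. dia (a \<sqinter> U))"
proof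
  show "dia (\<bottom> \<sqinter> U) = \<bottom>" by (simp add: dia_bot)
  show "dia ((a \<squnion> b) \<sqinter> U) = dia (a \<sqinter> U) \<squnion> dia (b \<sqinter> U)" for a b
    by (simp add: dia_sup inf_sup_distrib2)
  show "dia (dia (a \<sqinter> U) \<sqinter> U) \<le> dia (a \<sqinter> U)" for a
    by (meson dia_dia_le dia_mono inf_le1 order_trans)
qed

lemma settled_le:
  assumes "finite K" "e \<in> K"
  shows "settled dia K \<le> - ((e \<squnion> dia e) \<sqinter> dia (- dia e))"
  unfolding settled_def using assms by (intro compl_mono fjoin_upper) auto

text \<open>Violating the condition for some \<open>e\<close> passes to predecessors: by
  transitivity a predecessor sees \<open>e\<close> and also sees a point that does not see
  \<open>e\<close>. So the settled points form an upset, i.e. are closed under successors.\<close>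

lemma dia_uminus_settled_le:
  assumes "finite K"
  shows "dia (- settled dia K) \<le> - settled dia K"
proof -
  have "dia ((e \<squnion> dia e) \<sqinter> dia (- dia e)) \<le> (e \<squnion> dia e) \<sqinter> dia (- dia e)" for e
  proof (rule le_infI)
    have "dia ((e \<squnion> dia e) \<sqinter> dia (- dia e)) \<le> dia (e \<squnion> dia e)"
      by (simp add: dia_mono)
    also have "\<dots> \<le> e \<squnion> dia e"
      using dia_dia_le[of e] by (auto simp: dia_sup intro: le_supI2)
    finally show "dia ((e \<squnion> dia e) \<sqinter> dia (- dia e)) \<le> e \<squnion> dia e" .
    show "dia ((e \<squnion> dia e) \<sqinter> dia (- dia e)) \<le> dia (- dia e)"
      by (meson dia_dia_le dia_mono inf_le2 order_trans)
  qed
  moreover have "(e \<squnion> dia e) \<sqinter> dia (- dia e) \<le> - settled dia K" if "e \<in> K" for e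
    using settled_le[OF assms that] by (metis compl_le_swap1)
  ultimately have "dia ((e \<squnion> dia e) \<sqinter> dia (- dia e)) \<le> - settled dia K" if "e \<in> K" for e
    using that order_trans by blast
  then show ?thesis
    using assms by (simp add: settled_def dia_fjoin fjoin_le_iff)
qed

text \<open>Induction on the number of members of \<open>K\<close> that meet the upset
  \<open>z\<close>. If \<open>z\<close> violates the condition at \<open>e\<close>, the part
  \<open>y\<close> of \<open>z\<close> that does not see \<open>e\<close> is a smaller upset; it
  turns out to be zero, so that all of \<open>z\<close> sees \<open>e\<close>.\<close>

lemma upset_le_uminus_settled_eq_bot:
  assumes K: "finite K"
    and "dia (- z) \<le> - z" "z \<le> - settled dia K"
  shows "z = \<bottom>"
  using assms(2,3)
proof (induction "card {e \<in> K. z \<sqinter> e \<noteq> \<bottom>}" arbitrary: z rule: less_induct)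
  case less
  let ?F = "\<lambda>e. (e \<squnion> dia e) \<sqinter> dia (- dia e)"
  have z: "z \<le> fjoin (?F ` K)" using less.prems(2) by (simp add: settled_def)
  show ?case
  proof (rule ccontr)
    assume "z \<noteq> \<bottom>"
    have "\<exists>e\<in>K. z \<sqinter> ?F e \<noteq> \<bottom>"
    proof (rule ccontr)
      assume "\<not> ?thesis"
      then have "z \<sqinter> fjoin (?F ` K) \<le> \<bottom>"
        using K by (simp add: inf_fjoin fjoin_le_iff)
      then show False using z \<open>z \<noteq> \<bottom>\<close> by (simp add: inf_absorb1 bot_unique)
    qed
    then obtain e where e: "e \<in> K" "z \<sqinter> ?F e \<noteq> \<bottom>" by blast
    define y where "y = z \<sqinter> - dia e"
    have ze: "z \<sqinter> e \<noteq> \<bottom>"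
    proof
      assume "z \<sqinter> e = \<bottom>"
      then have "e \<le> - z" by (simp add: inf_shunt inf.commute)
      then have "e \<squnion> dia e \<le> - z"
        using less.prems(1) dia_mono by (meson le_supI order_trans)
      then have "?F e \<le> - z" by (rule le_infI1)
      then show False using e(2) by (metis inf_shunt inf.commute)
    qed
    have y_up: "dia (- y) \<le> - y"
    proof -
      have "dia (- y) = dia (- z) \<squnion> dia (dia e)" by (simp add: y_def dia_sup)
      also have "\<dots> \<le> - z \<squnion> dia e" using less.prems(1) dia_dia_le by (rule sup_mono)
      finally show ?thesis by (simp add: y_def)
    qed
    have "dia e \<le> - y" by (simp add: y_def)
    \<comment> \<open>Points of \<open>y\<close> do not see \<open>e\<close>, so removing
      \<open>e\<close> from \<open>y\<close> leaves an upset; it no longer meets \<open>e\<close>,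
      while \<open>z\<close> does.\<close>
    have "y \<sqinter> - e = \<bottom>"
    proof (rule less.hyps)
      have "{k \<in> K. y \<sqinter> - e \<sqinter> k \<noteq> \<bottom>} \<subseteq> {k \<in> K. z \<sqinter> k \<noteq> \<bottom>}"
      proof -
        have "y \<sqinter> - e \<sqinter> k \<le> z \<sqinter> k" for k
          unfolding y_def by (meson inf_le1 inf_mono order_refl order_trans)
        then show ?thesis by (metis (mono_tags, lifting) Collect_mono bot_unique)
      qed
      moreover have "e \<in> {k \<in> K. z \<sqinter> k \<noteq> \<bottom>}" using e(1) ze by simp
      moreover have "e \<notin> {k \<in> K. y \<sqinter> - e \<sqinter> k \<noteq> \<bottom>}" by (simp add: inf_assoc)
      ultimately show "card {k \<in> K. y \<sqinter> - e \<sqinter> k \<noteq> \<bottom>} < card {k \<in> K. z \<sqinter> k \<noteq> \<bottom>}"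
        using K by (intro psubset_card_mono psubsetI) (simp, assumption, metis)
      show "dia (- (y \<sqinter> - e)) \<le> - (y \<sqinter> - e)"
        using y_up \<open>dia e \<le> - y\<close> by (simp add: dia_sup le_supI1)
      show "y \<sqinter> - e \<le> - settled dia K"
        using less.prems(2) by (auto simp: y_def intro: le_infI1)
    qed
    then have "y \<le> e" by (simp add: inf_shunt)
    \<comment> \<open>An unsettled point has a successor. For a point of \<open>y\<close> it would
      lie in \<open>y\<close>, hence in \<open>e\<close>, which points of \<open>y\<close> do not
      see.\<close>
    have "?F k \<le> dia \<top>" for k by (simp add: dia_mono le_infI2)
    then have "fjoin (?F ` K) \<le> dia \<top>" using K by (simp add: fjoin_le_iff)
    then have "y \<le> dia \<top>" using z by (auto simp: y_def intro: le_infI1)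
    also have "dia \<top> = dia y \<squnion> dia (- y)" by (simp flip: dia_sup)
    also have "\<dots> \<le> - y"
      using y_up \<open>dia e \<le> - y\<close> dia_mono[OF \<open>y \<le> e\<close>] by (meson le_supI order_trans)
    finally have "y = \<bottom>" by (metis inf.idem inf_shunt)
    then have "z \<le> dia e" by (simp add: y_def inf_shunt)
    \<comment> \<open>Successors of points of \<open>z\<close> lie in \<open>z\<close>, so they see
      \<open>e\<close> too: nothing in \<open>z\<close> violates the condition at
      \<open>e\<close>.\<close>
    then have "dia (- dia e) \<le> - z"
      using less.prems(1) dia_mono by (meson compl_mono order_trans)
    then have "?F e \<le> - z" by (rule le_infI2)
    then show False using e(2) by (metis inf_shunt inf.commute)
  qed
qed

text \<open>The points that neither are settled nor see a settled point form an upset of unsettled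
  points. This replaces the existence of maximal points.\<close>

lemma settled_sup_dia_settled:
  assumes "finite K"
  shows "settled dia K \<squnion> dia (settled dia K) = \<top>"
proof -
  let ?T = "settled dia K"
  have "- (?T \<squnion> dia ?T) = \<bottom>"
  proof (rule upset_le_uminus_settled_eq_bot[OF assms])
    show "dia (- (- (?T \<squnion> dia ?T))) \<le> - (- (?T \<squnion> dia ?T))"
      using dia_dia_le[of ?T] by (simp add: dia_sup le_supI2)
  qed simp
  then show ?thesis by (metis compl_bot_eq double_compl)
qed

text \<open>A settled point agrees with all its successors on the colours they see, hence on every
  Boolean combination of the \<open>dia e\<close>.\<close>

lemma finite_cover_deciding_dia:
  assumes K: "finite K"
  shows "\<exists>R. finite R \<and> fjoin R = \<top> \<and>
    (\<forall>r\<in>R. settled dia K \<sqinter> dia (- r) \<le> - r \<and> (\<forall>e\<in>K. decides r (dia e)))"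
proof -
  let ?T = "settled dia K"
  define P where "P = {h. ?T \<sqinter> dia (- h) \<le> - h \<and> ?T \<sqinter> dia h \<le> h}"
  have "\<exists>R. finite R \<and> R \<subseteq> P \<and> fjoin R = \<top> \<and> (\<forall>r\<in>R. \<forall>e\<in>dia ` K. decides r e)"
  proof (rule finite_cover_deciding)
    show "finite (dia ` K)" using K by simp
    show "\<top> \<in> P" by (simp add: P_def dia_bot)
    show "- a \<in> P" if "a \<in> P" for a using that by (simp add: P_def)
    show "a \<sqinter> b \<in> P" if "a \<in> P" "b \<in> P" for a b
    proof -
      have "?T \<sqinter> dia (- (a \<sqinter> b)) = (?T \<sqinter> dia (- a)) \<squnion> (?T \<sqinter> dia (- b))"
        by (simp add: dia_sup inf_sup_distrib1)
      also have "\<dots> \<le> - a \<squnion> - b" using that unfolding P_def by (intro sup_mono) simp_all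
      finally have 1: "?T \<sqinter> dia (- (a \<sqinter> b)) \<le> - (a \<sqinter> b)" by simp
      have "?T \<sqinter> dia (a \<sqinter> b) \<le> (?T \<sqinter> dia a) \<sqinter> (?T \<sqinter> dia b)"
        by (simp add: dia_mono le_infI2)
      also have "\<dots> \<le> a \<sqinter> b" using that unfolding P_def by (intro inf_mono) simp_all
      finally have "?T \<sqinter> dia (a \<sqinter> b) \<le> a \<sqinter> b" .
      with 1 show ?thesis by (simp add: P_def)
    qed
    show "dia ` K \<subseteq> P"
    proof
      fix h assume "h \<in> dia ` K"
      then obtain e where e: "e \<in> K" "h = dia e" by blast
      \<comment> \<open>If a settled point sees \<open>e\<close>, so do all its successors;
        conversely, by transitivity, it sees whatever they see.\<close>
      have "?T \<le> - (dia e \<sqinter> dia (- dia e))"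
        using settled_le[OF K e(1)]
        by (rule order_trans) (intro compl_mono inf_mono sup_ge2 order_refl)
      then have "?T \<sqinter> dia (- dia e) \<le> - dia e"
        by (simp add: shunt1 sup.commute)
      moreover have "?T \<sqinter> dia (dia e) \<le> dia e"
        by (simp add: dia_dia_le le_infI2)
      ultimately show "h \<in> P" by (simp add: P_def e(2))
    qed
  qed
  then show ?thesis by (auto simp: P_def subset_iff)
qed

text \<open>The points of \<open>settled dia K \<sqinter> r\<close> see the same colours and form an
  upset, so their successors in \<open>U\<close> lie in the given cells. Either all of them see a
  cell contained in \<open>b\<close>, or none of them sees \<open>b\<close>.\<close>

lemma settled_decides_dia:
  assumes K: "finite K" "fjoin K = \<top>"
    and U: "\<And>a. dia (a \<sqinter> U) = dia a"
    and r: "settled dia K \<sqinter> dia (- r) \<le> - r" "\<forall>k\<in>K. decides r (dia k)"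
    and b: "\<forall>k\<in>K. decides (settled dia K \<sqinter> k \<sqinter> r \<sqinter> U) b"
  shows "decides (settled dia K \<sqinter> r) (dia b)"
proof -
  define T where "T = settled dia K"
  define x where "x = T \<sqinter> r"
  have x: "dia (- x) \<le> - x"
  proof -
    have "dia (- T) \<le> - x"
      using dia_uminus_settled_le[OF K(1)] by (simp add: x_def T_def le_supI1)
    moreover have "dia (- r) \<le> - x"
      using r(1) by (metis T_def compl_inf inf.commute shunt1 x_def)
    ultimately show ?thesis by (simp add: x_def dia_sup)
  qed
  have cell: "T \<sqinter> k \<sqinter> r \<sqinter> U = k \<sqinter> U \<sqinter> x" for k by (simp add: x_def ac_simps)
  show ?thesis
  proof (cases "\<exists>k\<in>K. k \<sqinter> U \<sqinter> x \<le> b \<and> r \<le> dia k")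
    case True
    then obtain k where k: "k \<sqinter> U \<sqinter> x \<le> b" "r \<le> dia k" by blast
    have "x \<le> dia (k \<sqinter> U)" using k(2) by (simp add: U x_def le_infI2)
    also have "\<dots> \<le> dia (k \<sqinter> U \<sqinter> x) \<squnion> dia (- x)" by (rule dia_le_dia_inf_sup)
    also have "\<dots> \<le> dia b \<squnion> - x" using dia_mono[OF k(1)] x by (rule sup_mono)
    finally have "x \<le> dia b"
      by (metis inf.idem shunt1 sup.commute)
    then show ?thesis by (simp add: decides_def x_def T_def)
  next
    case False
    have "dia (b \<sqinter> U \<sqinter> k) \<le> - x" if k: "k \<in> K" for k
    proof (cases "r \<le> dia k")
      case True
      then have "k \<sqinter> U \<sqinter> x \<le> - b"
        using False b k cell by (auto simp: decides_def T_def)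
      then have "b \<sqinter> U \<sqinter> k \<sqinter> x = \<bottom>"
        by (metis inf.commute inf.assoc inf_shunt)
      then have "b \<sqinter> U \<sqinter> k \<le> - x" by (simp add: inf_shunt)
      then show ?thesis using x dia_mono order_trans by blast
    next
      case False
      then have "r \<le> - dia k" using r(2) k by (auto simp: decides_def)
      then have "dia k \<le> - x"
        by (metis compl_le_swap1 inf_le2 order_trans x_def)
      then show ?thesis using dia_mono[of "b \<sqinter> U \<sqinter> k" k] order_trans by auto
    qed
    then have "dia (fjoin ((\<lambda>k. b \<sqinter> U \<sqinter> k) ` K)) \<le> - x"
      using K(1) by (simp add: dia_fjoin fjoin_le_iff)
    then have "dia b \<le> - x"
      using K by (simp add: inf_fjoin[symmetric] U)
    then show ?thesis
      by (metis compl_le_swap1 decides_def x_def T_def)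
  qed
qed

section \<open>Construction of the layers and the tower\<close>

lemma next_layer:
  assumes B: "subalgebra dia B" "B = subalgebra dia hull G" "finite G"
    and C: "finite C" "\<forall>c\<in>C. \<forall>b\<in>B. decides c b"
    and up: "fjoin C \<sqinter> dia (- fjoin C) = \<bottom>"
  shows "\<exists>C'. finite C' \<and> (\<forall>c\<in>C'. \<forall>b\<in>B. decides c b) \<and>
    fjoin C' \<sqinter> dia (- fjoin C') = \<bottom> \<and> fjoin C \<le> fjoin C' \<and>
    - fjoin C \<le> fjoin C' \<squnion> dia (fjoin C' \<sqinter> - fjoin C)"
proof -
  define D where "D = fjoin C"
  define d where "d = (\<lambda>a. dia (a \<sqinter> - D))"
  interpret d: K4_modal_algebra d unfolding d_def by (rule K4_relativize)
  have d_D: "d (a \<sqinter> - D) = d a" for a by (simp add: d_def inf_assoc)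
  obtain K where K: "finite K" "fjoin K = \<top>" "\<forall>k\<in>K. \<forall>e\<in>G \<union> dia ` C. decides k e"
    using finite_cover_deciding[of "G \<union> dia ` C" UNIV] B(3) C(1) by auto
  define T where "T = settled d K"
  obtain R where R: "finite R" "fjoin R = \<top>"
    "\<forall>r\<in>R. T \<sqinter> d (- r) \<le> - r \<and> (\<forall>e\<in>K. decides r (d e))"
    using d.finite_cover_deciding_dia[OF K(1)] unfolding T_def by blast
  \<comment> \<open>A cell of the new layer fixes a colour \<open>k\<close> and, through
    \<open>r\<close>, the colours seen outside \<open>D\<close>.\<close>
  define N where "N = (\<lambda>(k, r). T \<sqinter> k \<sqinter> r \<sqinter> - D) ` (K \<times> R)"
  have "finite N" using K(1) R(1) by (simp add: N_def)
  have fjoin_N: "fjoin N = T \<sqinter> - D"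
  proof (rule antisym)
    show "fjoin N \<le> T \<sqinter> - D"
      using \<open>finite N\<close> by (auto simp: fjoin_le_iff N_def intro: le_infI1)
    have 1: "T \<sqinter> - D \<sqinter> k \<sqinter> r \<le> fjoin N" if "k \<in> K" "r \<in> R" for k r
    proof -
      have "T \<sqinter> k \<sqinter> r \<sqinter> - D \<le> fjoin N"
        using that \<open>finite N\<close> by (intro fjoin_upper) (auto simp: N_def)
      then show ?thesis by (simp add: ac_simps)
    qed
    have "T \<sqinter> - D \<sqinter> k \<le> fjoin N" if "k \<in> K" for k
    proof -
      have "T \<sqinter> - D \<sqinter> k \<sqinter> fjoin R \<le> fjoin N"
        using 1[OF that] R(1) by (simp only: inf_fjoin) (simp add: fjoin_le_iff)
      then show ?thesis using R(2) by simp
    qed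
    then have "T \<sqinter> - D \<sqinter> fjoin K \<le> fjoin N"
      using K(1) by (simp only: inf_fjoin) (simp add: fjoin_le_iff)
    then show "T \<sqinter> - D \<le> fjoin N" using K(2) by simp
  qed
  \<comment> \<open>By minimality of the hull, \<open>S\<close> is all of \<open>B\<close> once it
    is a subalgebra containing \<open>G\<close>. Only closure under \<open>dia\<close> needs an
    argument.\<close>
  define S where "S = {b \<in> B. \<forall>c\<in>N. decides c b}"
  have "dia b \<in> S" if b: "b \<in> S" for b
  proof -
    have "b \<in> B" using b by (simp add: S_def)
    have "decides c (dia b)" if "c \<in> N" for c
    proof -
      obtain k r where kr: "k \<in> K" "r \<in> R" "c = T \<sqinter> k \<sqinter> r \<sqinter> - D"
        using \<open>c \<in> N\<close> by (auto simp: N_def)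
      \<comment> \<open>Successors inside and outside \<open>D\<close> are treated separately.
        Inside, \<open>b\<close> is a join of cells of \<open>C\<close>, and the colour
        \<open>k\<close> tells which of these are seen.\<close>
      have "decides k (fjoin (dia ` {c \<in> C. c \<le> b}))"
        using K(3) kr(1) C(1) by (intro decides_fjoin) auto
      moreover have "dia (b \<sqinter> D) = fjoin (dia ` {c \<in> C. c \<le> b})"
        using fjoin_decided_eq[of C b] C \<open>b \<in> B\<close> by (simp add: D_def dia_fjoin)
      ultimately have "decides c (dia (b \<sqinter> D))"
        using decides_mono[of k _ c] by (simp add: kr(3) le_infI1)
      moreover have "decides (T \<sqinter> r) (d b)"
        unfolding T_def
      proof (rule d.settled_decides_dia[OF K(1,2), where U = "- D"])
        show "d (a \<sqinter> - D) = d a" for a by (rule d_D)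
        show "settled d K \<sqinter> d (- r) \<le> - r" "\<forall>k\<in>K. decides r (d k)"
          using R(3) kr(2) by (auto simp: T_def)
        show "\<forall>k\<in>K. decides (settled d K \<sqinter> k \<sqinter> r \<sqinter> - D) b"
          using b kr(2) by (auto simp: S_def N_def T_def)
      qed
      then have "decides c (d b)"
        by (rule decides_mono) (simp add: kr(3) le_infI1)
      moreover have "dia b = dia (b \<sqinter> D) \<squnion> d b"
        by (simp add: d_def flip: dia_sup inf_sup_distrib1)
      ultimately show ?thesis by (simp add: decides_sup)
    qed
    then show ?thesis using \<open>b \<in> B\<close> B(1) by (simp add: S_def subalgebra_def)
  qed
  then have "subalgebra dia S"
    using B(1) unfolding subalgebra_def S_def
    by (auto intro: decides_sup decides_inf decides_uminus simp: decides_def[of _ \<bottom>] decides_def[of _ \<top>])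
  moreover have "G \<subseteq> S"
  proof
    fix g assume "g \<in> G"
    have "decides c g" if "c \<in> N" for c
    proof -
      obtain k r where kr: "k \<in> K" "c = T \<sqinter> k \<sqinter> r \<sqinter> - D"
        using \<open>c \<in> N\<close> by (auto simp: N_def)
      have "decides k g" using K(3) kr(1) \<open>g \<in> G\<close> by simp
      then show ?thesis by (rule decides_mono) (simp add: kr(2) le_infI1)
    qed
    then show "g \<in> S" using B(2) \<open>g \<in> G\<close> by (simp add: S_def hull_inc)
  qed
  ultimately have "B \<subseteq> S" using B(2) by (simp add: hull_minimal)
  then have 1: "\<forall>c\<in>C \<union> N. \<forall>b\<in>B. decides c b" using C(2) by (auto simp: S_def)
  have D': "fjoin (C \<union> N) = D \<squnion> T"
    using C(1) \<open>finite N\<close> by (simp add: fjoin_Un fjoin_N D_def sup_inf_distrib1)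
  \<comment> \<open>\<open>T\<close> is closed only under successors outside \<open>D\<close>; those
    inside \<open>D\<close> still lie in the new union.\<close>
  have 2: "(D \<squnion> T) \<sqinter> dia (- (D \<squnion> T)) = \<bottom>"
  proof -
    have "dia (- (D \<squnion> T)) \<le> dia (- D)" by (simp add: dia_mono)
    also have "\<dots> \<le> - D" using up by (metis D_def inf.commute inf_shunt)
    finally have "dia (- (D \<squnion> T)) \<le> - D" .
    moreover have "dia (- (D \<squnion> T)) \<le> - T"
      using d.dia_uminus_settled_le[OF K(1)] by (simp add: d_def T_def inf.commute)
    ultimately show ?thesis by (metis compl_sup inf.commute inf_shunt le_inf_iff)
  qed
  \<comment> \<open>Every remaining point lies in the new layer or sees it. This later makes each
    layer nonzero and the next layer see it.\<close>
  have 3: "- D \<le> D \<squnion> T \<squnion> dia ((D \<squnion> T) \<sqinter> - D)"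
  proof -
    have "T \<squnion> dia (T \<sqinter> - D) = \<top>"
      using d.settled_sup_dia_settled[OF K(1)] by (simp add: d_def T_def)
    moreover have "(D \<squnion> T) \<sqinter> - D = T \<sqinter> - D" by (simp add: inf_sup_distrib2)
    ultimately show ?thesis by (simp add: sup_assoc)
  qed
  show ?thesis
    using 1 2 3 C(1) \<open>finite N\<close> D' by (intro exI[of _ "C \<union> N"]) (simp flip: D_def)
qed

text \<open>A zero layer would leave nothing outside the preceding union, against
  \<open>proper\<close>. A point of layer \<open>i + 1\<close> lies outside \<open>D i\<close>, so
  by \<open>below\<close> it sees layer \<open>i\<close>; since \<open>D i\<close> is an upset, no
  point of layer \<open>i\<close> sees layer \<open>i + 1\<close>.\<close>

lemma descending_tower_of_layers:
  assumes mono: "\<And>n. D n \<le> D (Suc n)"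
    and up: "\<And>n. D n \<sqinter> dia (- D n) = \<bottom>"
    and below: "\<And>n. - D n \<le> D (Suc n) \<squnion> dia (D (Suc n) \<sqinter> - D n)"
    and proper: "\<And>n. D n \<noteq> \<top>"
  shows "descending_tower dia (\<lambda>n. D n \<sqinter> - D (n - 1))"
proof -
  \<comment> \<open>\<open>D 0\<close> precedes the first layer, so layers start at index 1, as
    towers do.\<close>
  let ?T = "\<lambda>n. D n \<sqinter> - D (n - 1)"
  have D_mono: "D m \<le> D n" if "m \<le> n" for m n
    using mono that by (rule lift_Suc_mono_le)
  have nonzero: "?T i \<noteq> \<bottom>" if "i \<ge> 1" for i
  proof
    assume "?T i = \<bottom>"
    then have "- D (i - 1) \<le> D i"
      using below[of "i - 1"] that by (simp add: dia_bot)
    moreover have "D i \<le> D (i - 1)"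
      using \<open>?T i = \<bottom>\<close> by (simp add: inf_shunt)
    ultimately have "- D (i - 1) \<le> D (i - 1)" by (rule order_trans)
    then have "D (i - 1) = \<top>" by (metis sup_neg_inf compl_sup_top sup.absorb2)
    then show False using proper by blast
  qed
  have disj: "?T i \<sqinter> ?T j = \<bottom>" if "i < j" for i j
  proof -
    have "?T i \<le> D (j - 1)" using D_mono[of i "j - 1"] that by (simp add: le_infI1)
    moreover have "?T j \<le> - D (j - 1)" by simp
    ultimately have "?T i \<sqinter> ?T j \<le> D (j - 1) \<sqinter> - D (j - 1)" by (rule inf_mono)
    then show ?thesis by (simp add: bot_unique)
  qed
  have below': "?T (i + 1) \<le> dia (?T i)" if "i \<ge> 1" for i
  proof -
    have "- D i \<le> - D (i - 1)" using D_mono[of "i - 1" i] by simp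
    also have "\<dots> \<le> D i \<squnion> dia (?T i)" using below[of "i - 1"] that by simp
    finally have "- D i \<le> dia (?T i)" by (metis inf.idem shunt1 double_compl)
    then show ?thesis by (simp add: le_infI2)
  qed
  have up': "?T i \<sqinter> dia (?T (i + 1)) = \<bottom>" for i
  proof -
    have "?T i \<sqinter> dia (?T (i + 1)) \<le> D i \<sqinter> dia (- D i)"
      by (intro inf_mono dia_mono) auto
    then show ?thesis by (simp add: up bot_unique)
  qed
  show ?thesis
    unfolding descending_tower_def
    using nonzero disj below' up' by (metis inf.commute linorder_neqE_nat)
qed

end

theorem mainTheorem1:
  fixes dia :: "'a::boolean_algebra \<Rightarrow> 'a"
  assumes "K4_modal_algebra dia"
    and "\<not> (\<exists>T. descending_tower dia T)"
  shows "locally_finite dia"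
proof -
  interpret K4_modal_algebra dia by (rule assms(1))
  have "finite B" if B: "subalgebra dia B" "B = subalgebra dia hull G" "finite G" for B G
  proof (rule ccontr)
    assume inf: "infinite B"
    let ?P = "\<lambda>C. finite C \<and> (\<forall>c\<in>C. \<forall>b\<in>B. decides c b) \<and>
      fjoin C \<sqinter> dia (- fjoin C) = \<bottom>"
    let ?Q = "\<lambda>C C'. fjoin C \<le> fjoin C' \<and>
      - fjoin C \<le> fjoin C' \<squnion> dia (fjoin C' \<sqinter> - fjoin C)"
    have "\<exists>C. \<forall>n. ?P (C n) \<and> ?Q (C n) (C (Suc n))"
    proof (rule dependent_nat_choice)
      \<comment> \<open>With no cells the union is zero, which is trivially an upset.\<close>
      show "\<exists>C. ?P C" by (rule exI[of _ "{}"]) simp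
      show "\<exists>C'. ?P C' \<and> ?Q C C'" if "?P C" for C and n :: nat
        using next_layer[OF B, of C] that by blast
    qed
    then obtain C where "\<forall>n. ?P (C n) \<and> ?Q (C n) (C (Suc n))" ..
    then have C: "?P (C n)" "?Q (C n) (C (Suc n))" for n by (metis (lifting))+
    have "fjoin (C n) \<noteq> \<top>" for n
      using finite_if_decided_by_cover[of "C n" B] C(1)[of n] inf by (intro notI) simp
    then have "descending_tower dia (\<lambda>n. fjoin (C n) \<sqinter> - fjoin (C (n - 1)))"
      using C by (intro descending_tower_of_layers[of "\<lambda>n. fjoin (C n)"]) simp_all
    then show False using assms(2) by blast
  qed
  then show ?thesis
    unfolding locally_finite_def finitely_generated_def by blast
qed

end
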